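(* Let $s$ and $L$ be positive integers with $L \ge s+1$. Then the coefficient of $q^n$ in $G_{L,s}(q)$ is positive for every integer $n \ge \delta'(s)$. In particular $G_{L,s}(q)$ is eventually positive.
   Context: A partition $\pi$ is a finite weakly decreasing sequence of positive integers; $|\pi|$ is the sum of its parts, $s(\pi)$ its smallest part and $l(\pi)$ its largest part. For positive integers $L,s$, $$G_{L,s}(q) := \sum_{\substack{\pi \text{ nonempty},\ s(\pi)=s,\\ l(\pi)-s(\pi)\le L}} q^{|\pi|} \;-\; \sum_{\substack{\pi \text{ nonempty},\ s(\pi)\ge s+1,\\ l(\pi)-s(\pi)\le L}} q^{|\pi|}.$$ A series $\sum_n a_n q^n$ is eventually positive if there is $l$ with $a_n>0$ for all $n \ge l$. Define, for positive integers $L,s$: $P_{L,s} = (s+1)(s+2)\cdots(s+L)$, $$\gamma(L,s) = \big((s+1)+(s+2)+\cdots+(s+L)\big)\cdot\Big(P_{L,s}^{(P_{L,s}^2-1)L+2} + \big((P_{L,s}^2-1)L-2\big)P_{L,s}\Big),$$ $\Gamma(s) = \gamma(3s+2,s)$, $\delta(s) = e^{3\Gamma(s)}$, and $\delta'(s) = 10s + (s+2)(s+3)(\delta(s)+1)$. *)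

theory Defs
  imports Complex_Main "HOL-Computational_Algebra.Formal_Power_Series"
begin

definition is_partition :: "nat list \<Rightarrow> bool" where
  "is_partition \<pi> \<longleftrightarrow> sorted_wrt (\<ge>) \<pi> \<and> (\<forall>p\<in>set \<pi>. p > 0)"

text \<open>The parts of a partition are the members of the list; these two are only meaningful for
  nonempty partitions.\<close>

definition smallest_part :: "nat list \<Rightarrow> nat" where
  "smallest_part \<pi> = Min (set \<pi>)"

definition largest_part :: "nat list \<Rightarrow> nat" where
  "largest_part \<pi> = Max (set \<pi>)"

text \<open>The formal sum of \<open>q ^ |\<pi>|\<close> over all \<open>\<pi>\<close> in a set \<open>A\<close> of partitions: its \<open>n\<close>-th coefficient
  counts the \<open>\<pi>\<close> in \<open>A\<close> of size \<open>n\<close>. By the lemma below the sets counted are finite, so the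
  convention that infinite sets have cardinality 0 plays no role.\<close>

definition partition_series :: "nat list set \<Rightarrow> int fps" where
  "partition_series A = Abs_fps (\<lambda>n. int (card {\<pi> \<in> A. sum_list \<pi> = n}))"

lemma finite_partitions_of_size:
  assumes "\<And>\<pi>. \<pi> \<in> A \<Longrightarrow> is_partition \<pi>"
  shows "finite {\<pi> \<in> A. sum_list \<pi> = n}"
proof (rule finite_subset)
  have len: "length \<pi> \<le> sum_list \<pi>" if "\<forall>p\<in>set \<pi>. p > 0" for \<pi> :: "nat list"
    using that by (induction \<pi>) auto
  show "{\<pi> \<in> A. sum_list \<pi> = n} \<subseteq> {\<pi>. set \<pi> \<subseteq> {..n} \<and> length \<pi> \<le> n}"
    using assms len by (auto simp: is_partition_def dest: member_le_sum_list)
  show "finite {\<pi>. set \<pi> \<subseteq> {..n} \<and> length \<pi> \<le> n}"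
    by (rule finite_lists_length_le) simp
qed

definition G :: "nat \<Rightarrow> nat \<Rightarrow> int fps" where
  "G L s =
     partition_series {\<pi>. is_partition \<pi> \<and> \<pi> \<noteq> [] \<and> smallest_part \<pi> = s \<and>
                          largest_part \<pi> - smallest_part \<pi> \<le> L}
   - partition_series {\<pi>. is_partition \<pi> \<and> \<pi> \<noteq> [] \<and> smallest_part \<pi> \<ge> s + 1 \<and>
                          largest_part \<pi> - smallest_part \<pi> \<le> L}"

definition eventually_positive :: "int fps \<Rightarrow> bool" where
  "eventually_positive F \<longleftrightarrow> (\<exists>l. \<forall>n\<ge>l. fps_nth F n > 0)"

definition P :: "nat \<Rightarrow> nat \<Rightarrow> nat" where
  "P L s = (\<Prod>i=1..L. s + i)"

text \<open>For positive \<open>L\<close> and \<open>s\<close> we have \<open>P L s \<ge> 2\<close>, hence \<open>((P L s)\<^sup>2 - 1) * L \<ge> 3\<close> and none of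
  the subtractions on natural numbers below is truncated.\<close>

definition \<gamma> :: "nat \<Rightarrow> nat \<Rightarrow> nat" where
  "\<gamma> L s = (\<Sum>i=1..L. s + i) *
     (P L s ^ (((P L s)\<^sup>2 - 1) * L + 2) + (((P L s)\<^sup>2 - 1) * L - 2) * P L s)"

definition \<Gamma> :: "nat \<Rightarrow> nat" where
  "\<Gamma> s = \<gamma> (3 * s + 2) s"

definition \<delta> :: "nat \<Rightarrow> real" where
  "\<delta> s = exp (3 * real (\<Gamma> s))"

definition \<delta>' :: "nat \<Rightarrow> real" where
  "\<delta>' s = 10 * real s + (real s + 2) * (real s + 3) * (\<delta> s + 1)"

end

theory Submission
  imports Defs "HOL-Library.Multiset"
begin

text \<open>Write \<open>F T\<close> for the generating function of partitions with parts in \<open>T\<close> and put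
  \<open>T = {s+1..s+L}\<close>. The sum over the smallest part of the second series in \<open>G\<close> telescopes after
  multiplication by \<open>1 - q^L\<close>, which gives \<open>G = F T * (F {s} - 1 - F {L}) + F {L}\<close>. Splitting off
  the parts \<open>s+1\<close> and \<open>s+2\<close>, let \<open>h = F {s+1, s+2} * (F {s} - 1 - F {L})\<close> and
  \<open>U = {s+3..s+L}\<close>, so that \<open>G = h * F U + F {L}\<close>. The number of partitions of \<open>n\<close> into parts
  \<open>s+1\<close> and \<open>s+2\<close> is within 1 of \<open>n / ((s+1)(s+2))\<close>, hence \<open>h\<close> grows quadratically at a
  rate independent of \<open>L \<ge> s+1\<close>; only its first \<open>N\<close> coefficients can be negative, with
  \<open>N\<close> polynomial in \<open>s\<close>. If \<open>q\<close> is large, every partition of \<open>q\<close> has a part of size at least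
  \<open>K\<close> or a part of multiplicity at least \<open>K\<close>; removing that part, respectively \<open>K\<close>
  copies of it, compares the few negative terms of the convolution of \<open>h\<close> and \<open>F U\<close> with positive
  ones that carry a weight \<open>h j \<ge> K\<close>. Everything works from a bound polynomial in \<open>s\<close>
  onwards, which \<open>\<delta>' s\<close> exceeds by far.\<close>

unbundle fps_syntax

section \<open>Generating functions of partitions with parts in a prescribed set\<close>

text \<open>Multisets stand for partitions here, so that adding or removing a part needs no
  reordering; \<open>bij_betw_mset_partitions\<close> connects them with the sorted lists.\<close>

definition parts_in :: "nat set \<Rightarrow> nat \<Rightarrow> nat multiset set" where
  "parts_in T n = {M. set_mset M \<subseteq> T \<and> sum_mset M = n}"

definition part_gf :: "nat set \<Rightarrow> int fps" where
  "part_gf T = Abs_fps (\<lambda>n. int (card (parts_in T n)))"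

lemma part_gf_nth [simp]: "part_gf T $ n = int (card (parts_in T n))"
  by (simp add: part_gf_def)

text \<open>A part 0 could be repeated freely, so it is excluded; positive parts bound both the
  entries and their number by \<open>n\<close>.\<close>

lemma finite_parts_in:
  assumes "0 \<notin> T"
  shows "finite (parts_in T n)"
proof (rule finite_subset)
  have len: "length xs \<le> sum_list xs" if "0 \<notin> set xs" for xs :: "nat list"
    using that by (induction xs) auto
  show "parts_in T n \<subseteq> mset ` {xs. set xs \<subseteq> {..n} \<and> length xs \<le> n}"
  proof
    fix M assume M: "M \<in> parts_in T n"
    obtain xs where xs: "M = mset xs" by (metis ex_mset)
    with M assms have "0 \<notin> set xs" "sum_list xs = n"
      by (auto simp: parts_in_def sum_mset_sum_list)
    with len[of xs] xs show "M \<in> mset ` {xs. set xs \<subseteq> {..n} \<and> length xs \<le> n}"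
      by (auto dest: member_le_sum_list)
  qed
  show "finite (mset ` {xs. set xs \<subseteq> {..n} \<and> length xs \<le> n})"
    by (intro finite_imageI finite_lists_length_le) simp
qed

lemma member_le_sum_mset: "x \<in># M \<Longrightarrow> x \<le> sum_mset M" for x :: nat
  by (auto dest!: multi_member_split)

text \<open>Only the empty multiset can survive. This serves for \<open>T\<close> empty and for
  windows of parts lying beyond \<open>n\<close>.\<close>

lemma parts_in_empty_sum:
  assumes "\<And>t. t \<in> T \<Longrightarrow> n < t"
  shows "card (parts_in T n) = (if n = 0 then 1 else 0)"
proof -
  have "parts_in T n \<subseteq> {{#}}"
  proof
    fix M assume M: "M \<in> parts_in T n"
    have "t \<notin># M" for t
    proof
      assume t: "t \<in># M"
      then have "t \<le> sum_mset M" by (rule member_le_sum_mset)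
      moreover have "t \<in> T" "sum_mset M = n" using M t by (auto simp: parts_in_def)
      ultimately show False using assms[of t] by simp
    qed
    then have "set_mset M = {}" by blast
    then show "M \<in> {{#}}" by simp
  qed
  moreover have "{#} \<in> parts_in T n \<longleftrightarrow> n = 0" by (auto simp: parts_in_def)
  ultimately show ?thesis by (cases "n = 0") (auto simp: subset_singleton_iff)
qed

text \<open>Split by whether \<open>t\<close> occurs; if it does, deleting one copy is a bijection
  onto the multisets with sum \<open>n - t\<close>.\<close>

lemma card_parts_in_insert:
  assumes "t \<notin> T" "t > 0" "0 \<notin> T"
  shows "card (parts_in (insert t T) n) =
    card (parts_in T n) + (if t \<le> n then card (parts_in (insert t T) (n - t)) else 0)"
proof -
  define A where "A = {M. add_mset t M \<in> parts_in (insert t T) n}"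
  have A: "A = (if t \<le> n then parts_in (insert t T) (n - t) else {})"
    by (auto simp: A_def parts_in_def)
  have "M \<in> parts_in T n \<union> add_mset t ` A" if "M \<in> parts_in (insert t T) n" for M
  proof (cases "t \<in># M")
    case True
    then obtain M' where "M = add_mset t M'" by (auto dest: multi_member_split)
    with that show ?thesis by (simp add: A_def)
  next
    case False
    with that show ?thesis by (auto simp: parts_in_def)
  qed
  then have "parts_in (insert t T) n = parts_in T n \<union> add_mset t ` A"
    by (auto simp: A_def parts_in_def)
  moreover have "parts_in T n \<inter> add_mset t ` A = {}" using assms by (auto simp: parts_in_def)
  moreover have "finite (parts_in T n)" "finite (add_mset t ` A)"
    unfolding A using assms by (auto intro: finite_parts_in)
  ultimately have "card (parts_in (insert t T) n) = card (parts_in T n) + card (add_mset t ` A)"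
    by (simp only: card_Un_disjoint)
  also have "card (add_mset t ` A) = card A" by (intro card_image inj_onI) simp
  finally show ?thesis unfolding A by simp
qed

lemma part_gf_insert:
  assumes "t \<notin> T" "t > 0" "0 \<notin> T"
  shows "part_gf (insert t T) * (1 - fps_X ^ t) = part_gf T"
  by (rule fps_ext)
     (auto simp: right_diff_distrib fps_X_power_mult_right_nth card_parts_in_insert[OF assms])

lemma part_gf_empty: "part_gf {} = 1"
  by (rule fps_ext) (simp only: part_gf_nth, subst parts_in_empty_sum, auto)

lemma part_gf_single: "d > 0 \<Longrightarrow> part_gf {d} * (1 - fps_X ^ d) = 1"
  using part_gf_insert[of d "{}"] by (simp add: part_gf_empty)

lemma part_gf_insert':
  assumes "t \<notin> T" "t > 0" "0 \<notin> T"
  shows "part_gf (insert t T) = part_gf T * part_gf {t}"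
proof -
  have "part_gf (insert t T) = part_gf (insert t T) * (part_gf {t} * (1 - fps_X ^ t))"
    using assms by (simp add: part_gf_single)
  also have "\<dots> = (part_gf (insert t T) * (1 - fps_X ^ t)) * part_gf {t}"
    by (simp only: ac_simps)
  finally show ?thesis by (simp add: part_gf_insert[OF assms])
qed

text \<open>\<open>part_gf {d}\<close> is the geometric series 1 / (1 - q^d), so the product
  \<open>g\<close> satisfies the recurrence \<open>g $ n = f $ n + g $ (n - d)\<close>, which
  unrolls in steps of \<open>d\<close>.\<close>

lemma mult_part_gf_single_nth:
  assumes "d > 0"
  shows "(f * part_gf {d}) $ n = (\<Sum>k\<le>n div d. f $ (n - k * d))"
proof -
  define g where "g = f * part_gf {d}"
  have "g * (1 - fps_X ^ d) = f"
    using part_gf_single[OF assms] by (simp add: g_def mult.assoc)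
  then have "(g - g * fps_X ^ d) $ n = f $ n" for n
    by (simp add: right_diff_distrib)
  then have rec: "g $ n = f $ n + (if n < d then 0 else g $ (n - d))" for n
    unfolding fps_sub_nth fps_X_power_mult_right_nth by (simp add: diff_eq_eq add.commute)
  have "g $ n = (\<Sum>k\<le>n div d. f $ (n - k * d))"
  proof (induction n rule: less_induct)
    case (less n)
    show ?case
    proof (cases "n < d")
      case False
      then have nd: "n div d = Suc ((n - d) div d)" using assms by (simp add: le_div_geq)
      have "g $ (n - d) = (\<Sum>k\<le>(n - d) div d. f $ (n - d - k * d))"
        using less[of "n - d"] assms False by simp
      also have "\<dots> = (\<Sum>k\<le>(n - d) div d. f $ (n - Suc k * d))" by simp
      finally have "g $ n = f $ n + (\<Sum>k\<le>(n - d) div d. f $ (n - Suc k * d))"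
        using False rec[of n] by simp
      then show ?thesis unfolding nd sum.atMost_Suc_shift by simp
    next
      case True
      then show ?thesis using rec[of n] by simp
    qed
  qed
  then show ?thesis by (simp add: g_def)
qed

section \<open>Partitions with bounded spread, and a product formula for \<open>G\<close>\<close>

text \<open>Each multiset of positive integers has exactly one weakly decreasing listing.\<close>

lemma bij_betw_mset_partitions:
  "bij_betw mset {\<pi>. is_partition \<pi> \<and> Q (mset \<pi>)} {M. 0 \<notin># M \<and> Q M}"
proof (rule bij_betw_imageI)
  show "inj_on mset {\<pi>. is_partition \<pi> \<and> Q (mset \<pi>)}"
  proof (rule inj_onI)
    fix x y :: "nat list"
    assume "x \<in> {\<pi>. is_partition \<pi> \<and> Q (mset \<pi>)}" "y \<in> {\<pi>. is_partition \<pi> \<and> Q (mset \<pi>)}"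
      and xy: "mset x = mset y"
    then have "sorted (rev x)" "sorted (rev y)"
      by (auto simp: is_partition_def sorted_wrt_rev)
    with xy have "rev x = rev y" by (metis mset_rev properties_for_sort)
    then show "x = y" by simp
  qed
  show "mset ` {\<pi>. is_partition \<pi> \<and> Q (mset \<pi>)} = {M. 0 \<notin># M \<and> Q M}"
  proof (intro equalityI subsetI)
    fix M assume M: "M \<in> {M. 0 \<notin># M \<and> Q M}"
    have "sorted_wrt (\<ge>) (rev (sorted_list_of_multiset M))"
      by (simp add: sorted_wrt_rev)
    with M show "M \<in> mset ` {\<pi>. is_partition \<pi> \<and> Q (mset \<pi>)}"
      by (intro image_eqI[of _ _ "rev (sorted_list_of_multiset M)"])
         (auto simp: is_partition_def intro: Nat.gr0I)
  qed (auto simp: is_partition_def)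
qed

text \<open>Slices by the exact smallest part: the first series in \<open>G\<close> is the slice
  \<open>m = s\<close>, the second is the sum of the slices with \<open>m > s\<close>.\<close>

definition min_parts :: "nat \<Rightarrow> nat \<Rightarrow> nat \<Rightarrow> nat multiset set" where
  "min_parts L m n = {M. 0 \<notin># M \<and> M \<noteq> {#} \<and> Min (set_mset M) = m \<and>
     Max (set_mset M) - m \<le> L \<and> sum_mset M = n}"

lemma min_parts_alt:
  "min_parts L m n = {M. 0 \<notin># M \<and> (M \<noteq> {#} \<and> Min (set_mset M) = m \<and>
     Max (set_mset M) - Min (set_mset M) \<le> L) \<and> sum_mset M = n}"
  unfolding min_parts_def by blast

text \<open>Removing one copy of the smallest part leaves an arbitrary, possibly empty, multiset
  from the window.\<close>

lemma min_parts_eq: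
  assumes "m > 0"
  shows "min_parts L m n = (if m \<le> n then add_mset m ` parts_in {m..m + L} (n - m) else {})"
proof (intro equalityI subsetI)
  fix M assume M: "M \<in> min_parts L m n"
  then have "m \<in># M" unfolding min_parts_def
    by (metis (mono_tags, lifting) Min_in finite_set_mset mem_Collect_eq set_mset_eq_empty_iff)
  then obtain M' where M': "M = add_mset m M'" by (auto dest: multi_member_split)
  have "m \<le> x \<and> x \<le> m + L" if "x \<in># M" for x
  proof -
    have "x \<le> Max (set_mset M)" "Min (set_mset M) \<le> x" using that by auto
    with M show ?thesis by (auto simp: min_parts_def)
  qed
  with M M' show "M \<in> (if m \<le> n then add_mset m ` parts_in {m..m + L} (n - m) else {})"
    by (auto simp: parts_in_def min_parts_def)
next
  fix M assume "M \<in> (if m \<le> n then add_mset m ` parts_in {m..m + L} (n - m) else {})"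
  then obtain M' where M': "M = add_mset m M'" "M' \<in> parts_in {m..m + L} (n - m)" "m \<le> n"
    by (auto split: if_splits)
  then have b: "\<And>x. x \<in># M \<Longrightarrow> m \<le> x \<and> x \<le> m + L" and mM: "m \<in># M"
    by (auto simp: parts_in_def)
  have "Min (set_mset M) = m" using b mM by (intro Min_eqI) auto
  moreover have "Max (set_mset M) - m \<le> L"
  proof -
    have "Max (set_mset M) \<in># M" using mM by (intro Max_in) auto
    with b show ?thesis by fastforce
  qed
  moreover have "0 \<notin># M" using b assms by force
  moreover have "M \<noteq> {#}" "sum_mset M = n" using M' by (auto simp: parts_in_def)
  ultimately show "M \<in> min_parts L m n" unfolding min_parts_def by blast
qed

lemma finite_min_parts: "m > 0 \<Longrightarrow> finite (min_parts L m n)"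
  by (simp add: min_parts_eq finite_parts_in)

lemma card_min_parts:
  assumes "m > 0"
  shows "int (card (min_parts L m n)) = (fps_X ^ m * part_gf {m..m + L}) $ n"
proof -
  have "card (add_mset m ` parts_in {m..m + L} (n - m)) = card (parts_in {m..m + L} (n - m))"
    by (intro card_image inj_onI) auto
  then show ?thesis using assms by (simp add: min_parts_eq fps_X_power_mult_nth)
qed

text \<open>The factors 1 - q^m and 1 - q^(m+L) delete the lower and the upper end of the window
  \<open>{m..m + L}\<close>, and they differ by q^m (1 - q^L).\<close>

lemma part_gf_window:
  assumes "m > 0" "L > 0"
  shows "fps_X ^ m * part_gf {m..m + L} * (1 - fps_X ^ L) =
    part_gf {m..<m + L} - part_gf {Suc m..<Suc m + L}"
proof -
  have "{m..m + L} = insert m {Suc m..<Suc m + L}" by auto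
  then have 1: "part_gf {m..m + L} * (1 - fps_X ^ m) = part_gf {Suc m..<Suc m + L}"
    using assms part_gf_insert[of m "{Suc m..<Suc m + L}"] by simp
  have "{m..m + L} = insert (m + L) {m..<m + L}" by auto
  then have 2: "part_gf {m..m + L} * (1 - fps_X ^ (m + L)) = part_gf {m..<m + L}"
    using assms part_gf_insert[of "m + L" "{m..<m + L}"] by simp
  show ?thesis unfolding 1[symmetric] 2[symmetric] by (simp add: algebra_simps power_add)
qed

lemma sum_part_gf_window:
  assumes "L > 0" "s \<le> n"
  shows "(\<Sum>m=Suc s..n. fps_X ^ m * part_gf {m..m + L}) * (1 - fps_X ^ L) =
    part_gf {Suc s..<Suc s + L} - part_gf {Suc n..<Suc n + L}"
proof -
  have "(\<Sum>m=Suc s..n. fps_X ^ m * part_gf {m..m + L}) * (1 - fps_X ^ L) =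
     (\<Sum>m=Suc s..n. part_gf {m..<m + L} - part_gf {Suc m..<Suc m + L})"
    unfolding sum_distrib_right by (intro sum.cong refl part_gf_window) (use assms in auto)
  also have "\<dots> = part_gf {Suc s..<Suc s + L} - part_gf {Suc n..<Suc n + L}"
    using \<open>s \<le> n\<close> by (induction n rule: dec_induct) auto
  finally show ?thesis .
qed

text \<open>The slices are summed by telescoping; multiplying by \<open>part_gf {L}\<close>, the
  inverse of 1 - q^L, then recovers the sum itself.\<close>

lemma sum_min_parts:
  assumes "L > 0"
  shows "(\<Sum>m=Suc s..n. int (card (min_parts L m n))) =
    ((part_gf {Suc s..s + L} - 1) * part_gf {L}) $ n"
proof -
  \<comment> \<open>The telescoping needs an upper end of at least \<open>s\<close>; slices with
    \<open>m > n\<close> are empty, so enlarging the range is harmless.\<close>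
  define N where "N = max s n"
  have "(\<Sum>m=Suc s..n. int (card (min_parts L m n))) =
      (\<Sum>m=Suc s..N. int (card (min_parts L m n)))"
    by (rule sum.mono_neutral_left) (auto simp: N_def min_parts_eq)
  also have "\<dots> = (\<Sum>m=Suc s..N. fps_X ^ m * part_gf {m..m + L}) $ n"
    unfolding fps_sum_nth by (intro sum.cong) (auto simp: card_min_parts simp del: part_gf_nth)
  also have "(\<Sum>m=Suc s..N. fps_X ^ m * part_gf {m..m + L}) =
     (\<Sum>m=Suc s..N. fps_X ^ m * part_gf {m..m + L}) * (part_gf {L} * (1 - fps_X ^ L))"
    by (simp add: part_gf_single assms)
  also have "\<dots> = (\<Sum>m=Suc s..N. fps_X ^ m * part_gf {m..m + L}) * (1 - fps_X ^ L) * part_gf {L}"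
    by (simp only: ac_simps)
  also have "\<dots> = (part_gf {Suc s..<Suc s + L} - part_gf {Suc N..<Suc N + L}) * part_gf {L}"
    by (subst sum_part_gf_window) (use assms in \<open>auto simp: N_def\<close>)
  \<comment> \<open>All parts in the last window exceed \<open>n\<close>, so its series agrees with
    1 up to degree \<open>n\<close>.\<close>
  also have "\<dots> $ n = ((part_gf {Suc s..<Suc s + L} - 1) * part_gf {L}) $ n"
    unfolding fps_mult_nth
  proof (intro sum.cong refl)
    fix i assume "i \<in> {0..n}"
    then have "card (parts_in {Suc N..<Suc N + L} i) = (if i = 0 then 1 else 0)"
      by (intro parts_in_empty_sum) (auto simp: N_def)
    then show "(part_gf {Suc s..<Suc s + L} - part_gf {Suc N..<Suc N + L}) $ i * part_gf {L} $ (n - i) =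
      (part_gf {Suc s..<Suc s + L} - 1) $ i * part_gf {L} $ (n - i)" by simp
  qed
  finally show ?thesis by (simp add: atLeastLessThanSuc_atLeastAtMost)
qed

lemma partition_series_nth:
  "partition_series {\<pi>. is_partition \<pi> \<and> Q (mset \<pi>)} $ n =
     int (card {M. 0 \<notin># M \<and> Q M \<and> sum_mset M = n})"
proof -
  have "bij_betw mset {\<pi>. is_partition \<pi> \<and> (Q (mset \<pi>) \<and> sum_mset (mset \<pi>) = n)}
     {M. 0 \<notin># M \<and> (Q M \<and> sum_mset M = n)}"
    by (rule bij_betw_mset_partitions)
  then show ?thesis
    by (simp add: partition_series_def bij_betw_same_card sum_mset_sum_list conj_assoc)
qed

text \<open>Split the part \<open>s\<close> off the window and absorb q^s, using that
  \<open>part_gf {s}\<close> times q^s is \<open>part_gf {s} - 1\<close>.\<close>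

lemma series_smallest_part_eq:
  assumes "s > 0"
  shows "partition_series {\<pi>. is_partition \<pi> \<and> \<pi> \<noteq> [] \<and> smallest_part \<pi> = s \<and>
      largest_part \<pi> - smallest_part \<pi> \<le> L} = part_gf {Suc s..s + L} * (part_gf {s} - 1)"
    (is "?F = _")
proof (rule fps_ext)
  fix n
  have ins: "{s..s + L} = insert s {Suc s..s + L}" by auto
  have "?F $ n = int (card (min_parts L s n))"
    using partition_series_nth[of "\<lambda>M. M \<noteq> {#} \<and> Min (set_mset M) = s \<and>
      Max (set_mset M) - Min (set_mset M) \<le> L" n]
    unfolding min_parts_alt smallest_part_def largest_part_def by simp
  also have "\<dots> = (fps_X ^ s * part_gf {s..s + L}) $ n"
    by (rule card_min_parts[OF assms])
  also have "part_gf {s..s + L} = part_gf {Suc s..s + L} * part_gf {s}"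
    unfolding ins using assms by (intro part_gf_insert') auto
  also have "fps_X ^ s * (part_gf {Suc s..s + L} * part_gf {s}) =
      part_gf {Suc s..s + L} * (part_gf {s} * fps_X ^ s)"
    by (simp only: ac_simps)
  also have "part_gf {s} * fps_X ^ s = part_gf {s} - 1"
    using part_gf_single[OF assms]
    by (simp add: right_diff_distrib diff_eq_eq eq_diff_eq add.commute)
  finally show "?F $ n = (part_gf {Suc s..s + L} * (part_gf {s} - 1)) $ n" .
qed

text \<open>The smallest part of a partition of \<open>n\<close> is at most \<open>n\<close>, so
  finitely many disjoint slices cover everything.\<close>

lemma series_smallest_part_ge:
  assumes "L > 0"
  shows "partition_series {\<pi>. is_partition \<pi> \<and> \<pi> \<noteq> [] \<and> smallest_part \<pi> \<ge> s + 1 \<and>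
      largest_part \<pi> - smallest_part \<pi> \<le> L} = (part_gf {Suc s..s + L} - 1) * part_gf {L}"
    (is "?F = _")
proof (rule fps_ext)
  fix n
  have "{M. 0 \<notin># M \<and> (M \<noteq> {#} \<and> Min (set_mset M) \<ge> s + 1 \<and>
      Max (set_mset M) - Min (set_mset M) \<le> L) \<and> sum_mset M = n} = (\<Union>m\<in>{Suc s..n}. min_parts L m n)"
    (is "?B = ?U")
  proof (intro equalityI subsetI)
    fix M assume M: "M \<in> ?B"
    then have "Min (set_mset M) \<in># M" by (intro Min_in) auto
    then have "Min (set_mset M) \<le> sum_mset M" by (rule member_le_sum_mset)
    with M have "M \<in> min_parts L (Min (set_mset M)) n" "Min (set_mset M) \<in> {Suc s..n}"
      unfolding min_parts_alt by simp_all
    then show "M \<in> ?U" by blast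
  next
    fix M assume "M \<in> ?U"
    then obtain m where "m \<in> {Suc s..n}" "M \<in> min_parts L m n" by blast
    moreover from this have m: "Min (set_mset M) = m" by (simp add: min_parts_def)
    ultimately show "M \<in> ?B" unfolding min_parts_alt m[symmetric] by simp
  qed
  moreover have "card ?U = (\<Sum>m=Suc s..n. card (min_parts L m n))"
  proof (rule card_UN_disjoint)
    show "\<forall>i\<in>{Suc s..n}. \<forall>j\<in>{Suc s..n}. i \<noteq> j \<longrightarrow> min_parts L i n \<inter> min_parts L j n = {}"
      unfolding min_parts_def by blast
  qed (simp_all add: finite_min_parts)
  ultimately have "?F $ n = (\<Sum>m=Suc s..n. int (card (min_parts L m n)))"
    using partition_series_nth[of "\<lambda>M. M \<noteq> {#} \<and> Min (set_mset M) \<ge> s + 1 \<and>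
      Max (set_mset M) - Min (set_mset M) \<le> L" n]
    unfolding smallest_part_def largest_part_def by simp
  then show "?F $ n = ((part_gf {Suc s..s + L} - 1) * part_gf {L}) $ n"
    using sum_min_parts[OF assms, where s = s and n = n] by (simp only:)
qed

lemma G_eq:
  assumes "s > 0" "L > 0"
  shows "G L s = part_gf {Suc s..s + L} * (part_gf {s} - 1 - part_gf {L}) + part_gf {L}"
  unfolding G_def series_smallest_part_eq[OF assms(1)] series_smallest_part_ge[OF assms(2)]
  by (simp add: algebra_simps)

section \<open>Partitions into parts \<open>s + 1\<close> and \<open>s + 2\<close>, and quadratic
  growth of \<open>h\<close>\<close>

lemma card_parts_in_single:
  assumes "d > 0"
  shows "card (parts_in {d} n) = (if d dvd n then 1 else 0)"
proof (induction n rule: less_induct)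
  case (less n)
  have "card (parts_in {d} n) = (if n = 0 then 1 else 0) +
      (if d \<le> n then card (parts_in {d} (n - d)) else 0)"
    using card_parts_in_insert[of d "{}" n] parts_in_empty_sum[of "{}" n] assms by simp
  with less[of "n - d"] assms show ?case
    by (auto simp: dvd_minus_self dest: dvd_imp_le)
qed

text \<open>With exactly k parts there is one such partition if k(s+1) \<le> n \<le> k(s+2), and
  none otherwise; the formula counts these k, the second quotient being the ceiling of n/(s+2). The
  proof checks it by induction, removing a part \<open>s + 1\<close>.\<close>

lemma card_parts_in_pair:
  "int (card (parts_in {Suc s, Suc (Suc s)} n)) = int (n div (s + 1)) + 1 - int ((n + s + 1) div (s + 2))"
proof (induction n rule: less_induct)
  case (less n)
  have rec: "card (parts_in {Suc s, Suc (Suc s)} n) = (if s + 2 dvd n then 1 else 0) +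
      (if Suc s \<le> n then card (parts_in {Suc s, Suc (Suc s)} (n - Suc s)) else 0)"
    using card_parts_in_insert[of "Suc s" "{Suc (Suc s)}" n] by (simp add: card_parts_in_single)
  show ?case
  proof (cases "Suc s \<le> n")
    case True
    then obtain k where n: "n = k + Suc s" by (metis add.commute le_Suc_ex)
    have IH: "int (card (parts_in {Suc s, Suc (Suc s)} k)) =
        int (k div (s + 1)) + 1 - int ((k + s + 1) div (s + 2))"
      using less[of k] n by simp
    have "n div (s + 1) = k div (s + 1) + 1"
      using div_add_self2[of "s + 1" k] n by simp
    \<comment> \<open>The ceiling term at \<open>k\<close> equals \<open>n div (s + 2)\<close>.
      Ceiling and floor of n/(s+2) differ by 1 unless \<open>s + 2\<close> divides \<open>n\<close>,
      which matches the divisibility term of \<open>rec\<close>.\<close>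
    moreover have "(n + s + 1) div (s + 2) = (if s + 2 dvd n then 0 else 1) + n div (s + 2)"
    proof -
      have one: "(r + (s + 1)) div (s + 2) = 1" if "0 < r" "r < s + 2" for r
        by (rule div_nat_eqI) (use that in auto)
      have "n mod (s + 2) + n div (s + 2) * (s + 2) = n" by (rule mod_div_mult_eq)
      then have "n + s + 1 = n mod (s + 2) + (s + 1) + n div (s + 2) * (s + 2)" by linarith
      then have "(n + s + 1) div (s + 2) = n div (s + 2) + (n mod (s + 2) + (s + 1)) div (s + 2)"
        by (simp only: div_mult_self1)
      also have "(n mod (s + 2) + (s + 1)) div (s + 2) = (if s + 2 dvd n then 0 else 1)"
      proof (cases "s + 2 dvd n")
        case False
        then have "n mod (s + 2) > 0" by (simp add: mod_greater_zero_iff_not_dvd)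
        moreover have "n mod (s + 2) < s + 2" by simp
        ultimately show ?thesis using False one by simp
      qed (simp add: dvd_imp_mod_0)
      finally show ?thesis by simp
    qed
    ultimately show ?thesis using rec IH n by (auto simp: add_ac)
  next
    case False
    then have "(n + s + 1) div (s + 2) = (if n = 0 then 0 else 1)" by (auto intro!: div_nat_eqI)
    moreover have "s + 2 dvd n \<longleftrightarrow> n = 0" using False by (auto dest: dvd_imp_le)
    ultimately show ?thesis using rec False by simp
  qed
qed

text \<open>The main terms differ by n/(s+1) - n/(s+2), which is \<open>c * n\<close>; floor and
  ceiling perturb this by a bounded amount.\<close>

lemma card_parts_in_pair_bounds:
  fixes s n :: nat
  defines "p \<equiv> real (card (parts_in {Suc s, Suc (Suc s)} n))"
  defines "c \<equiv> 1 / ((real s + 1) * (real s + 2))"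
  shows "c * real n - 1 \<le> p" "p \<le> c * real n + 1"
proof -
  have "real_of_int (int (card (parts_in {Suc s, Suc (Suc s)} n))) =
      real_of_int (int (n div (s + 1)) + 1 - int ((n + s + 1) div (s + 2)))"
    by (simp only: card_parts_in_pair)
  then have p: "p = real (n div (s + 1)) + 1 - real ((n + s + 1) div (s + 2))"
    by (simp add: p_def)
  \<comment> \<open>The term \<open>1 / real d\<close>, due to remainders being at most
    \<open>d - 1\<close>, cancels the one in \<open>e\<close>, so that the ceiling is bounded below
    by n/(s+2) itself.\<close>
  have dv: "real m / real d - 1 + 1 / real d \<le> real (m div d) \<and> real (m div d) \<le> real m / real d" if "d > 0" for m d
  proof -
    have "m mod d + 1 \<le> d" using that by (simp add: Suc_leI)
    moreover have "m = m div d * d + m mod d" by simp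
    ultimately have "real m + 1 \<le> real (m div d) * real d + real d" "real (m div d) * real d \<le> real m"
      by (metis add.assoc add_le_mono le_refl of_nat_1 of_nat_add of_nat_le_iff of_nat_mult,
          metis le_add1 of_nat_le_iff of_nat_mult)
    then show ?thesis using that by (simp add: field_simps)
  qed
  have c: "c * real n = real n / (real s + 1) - real n / (real s + 2)"
    by (simp add: c_def field_simps)
  have e: "real (n + s + 1) / real (s + 2) = real n / (real s + 2) + 1 - 1 / (real s + 2)"
  proof -
    have "real (n + s + 1) = real n + (real s + 2) - 1" by simp
    moreover have "(real s + 2) / (real s + 2) = 1" by simp
    ultimately show ?thesis
      by (metis add_divide_distrib diff_divide_distrib of_nat_add of_nat_numeral)
  qed
  have pos: "1 / (real s + 1) \<ge> 0" "1 / (real s + 2) \<ge> 0" by simp_all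
  have "real n / (real s + 1) - 1 + 1 / (real s + 1) \<le> real (n div (s + 1))"
    "real (n div (s + 1)) \<le> real n / (real s + 1)"
    using dv[of "s + 1" n] by (simp_all add: add_ac)
  moreover have "real (n + s + 1) / real (s + 2) - 1 + 1 / (real s + 2) \<le> real ((n + s + 1) div (s + 2))"
    "real ((n + s + 1) div (s + 2)) \<le> real (n + s + 1) / real (s + 2)"
    using dv[of "s + 2" "n + s + 1"] by (simp_all add: add_ac)
  ultimately show "c * real n - 1 \<le> p" "p \<le> c * real n + 1"
    using c e pos unfolding p by linarith+
qed

lemma sum_linear_progression:
  "(\<Sum>k\<le>I. a - real k * d) = (real I + 1) * a - d * real I * (real I + 1) / 2"
  by (induction I) (simp_all add: field_simps)

text \<open>Summing the linear count in steps of \<open>s\<close> gives at least about c n^2 / (2s),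
  in steps of \<open>L\<close> at most about c n^2 / (2(s+1)), because \<open>L\<close> is at least
  \<open>s + 1\<close>. The difference of these is the quadratic term; the rest is linear
  error.\<close>

lemma pair_convolution_lower_bound:
  fixes s L n :: nat
  defines "h \<equiv> part_gf {Suc s, Suc (Suc s)} * (part_gf {s} - 1 - part_gf {L})"
  assumes "s > 0" "L > s"
  shows "real_of_int (h $ n) \<ge>
    (real n)\<^sup>2 / (2 * real s * (real s + 1)\<^sup>2 * (real s + 2)) - 3 * real n - 3"
proof -
  define p where "p = (\<lambda>m. real (card (parts_in {Suc s, Suc (Suc s)} m)))"
  define c where "c = 1 / ((real s + 1) * (real s + 2))"
  define I J where "I = n div s" and "J = n div L"
  have "c \<le> 1 / (1 * 2)" unfolding c_def by (intro divide_left_mono mult_mono) auto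
  then have c01: "c > 0" "c \<le> 1 / 2" by (simp_all add: c_def)
  have "h = part_gf {Suc s, Suc (Suc s)} * part_gf {s} - part_gf {Suc s, Suc (Suc s)}
      - part_gf {Suc s, Suc (Suc s)} * part_gf {L}"
    by (simp add: h_def algebra_simps)
  then have h: "real_of_int (h $ n) = (\<Sum>k\<le>I. p (n - k * s)) - p n - (\<Sum>k\<le>J. p (n - k * L))"
    using assms by (simp add: mult_part_gf_single_nth p_def I_def J_def)
  have "(\<Sum>k\<le>I. p (n - k * s)) \<ge> (\<Sum>k\<le>I. c * (real n - real k * real s) - 1)"
  proof (rule sum_mono)
    fix k assume "k \<in> {..I}"
    then have "k * s \<le> n" using assms by (simp add: I_def less_eq_div_iff_mult_less_eq)
    then show "p (n - k * s) \<ge> c * (real n - real k * real s) - 1"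
      using card_parts_in_pair_bounds(1)[of s "n - k * s"] by (simp add: p_def c_def of_nat_diff)
  qed
  also have "(\<Sum>k\<le>I. c * (real n - real k * real s) - 1) =
      c * (\<Sum>k\<le>I. real n - real k * real s) - (real I + 1)"
    by (simp add: sum_subtractf sum_distrib_left[symmetric] right_diff_distrib)
  finally have A: "(\<Sum>k\<le>I. p (n - k * s)) \<ge> c * (\<Sum>k\<le>I. real n - real k * real s) - (real I + 1)" .
  have "(\<Sum>k\<le>J. p (n - k * L)) \<le> (\<Sum>k\<le>J. c * (real n - real k * real L) + 1)"
  proof (rule sum_mono)
    fix k assume "k \<in> {..J}"
    then have "k * L \<le> n" using assms by (simp add: J_def less_eq_div_iff_mult_less_eq)
    then show "p (n - k * L) \<le> c * (real n - real k * real L) + 1"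
      using card_parts_in_pair_bounds(2)[of s "n - k * L"] by (simp add: p_def c_def of_nat_diff)
  qed
  also have "(\<Sum>k\<le>J. c * (real n - real k * real L) + 1) =
      c * (\<Sum>k\<le>J. real n - real k * real L) + (real J + 1)"
    by (simp add: sum.distrib sum_subtractf sum_distrib_left[symmetric] right_diff_distrib)
  finally have B: "(\<Sum>k\<le>J. p (n - k * L)) \<le> c * (\<Sum>k\<le>J. real n - real k * real L) + (real J + 1)" .
  have A': "(\<Sum>k\<le>I. real n - real k * real s) \<ge> (real n)\<^sup>2 / (2 * real s)"
  proof -
    define r where "r = n mod s"
    have n: "real n = real I * real s + real r"
      unfolding I_def r_def by (metis div_mult_mod_eq of_nat_add of_nat_mult)
    have r: "real r \<le> real s" using assms by (simp add: r_def less_imp_le)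
    \<comment> \<open>This is \<open>2 * s\<close> times the difference of the two sides of the
      claim.\<close>
    have "0 \<le> real r * (2 * real s - real r) + (real s)\<^sup>2 * real I"
      using r by (intro add_nonneg_nonneg mult_nonneg_nonneg) auto
    also have "\<dots> = 2 * real s * ((real I + 1) * real n - real s * real I * (real I + 1) / 2) - (real n)\<^sup>2"
      unfolding n by (simp add: field_simps power2_eq_square)
    finally show ?thesis unfolding sum_linear_progression using assms by (simp add: field_simps)
  qed
  have B': "(\<Sum>k\<le>J. real n - real k * real L) \<le> real n + (real n)\<^sup>2 / (2 * (real s + 1))"
  proof -
    \<comment> \<open>Completing the square in \<open>L * J\<close> bounds the sum.\<close>
    have "0 \<le> (real n - real L * real J)\<^sup>2 + (real L)\<^sup>2 * real J" by simp
    also have "\<dots> = 2 * real L * (real n - ((real J + 1) * real n - real L * real J * (real J + 1) / 2)) + (real n)\<^sup>2"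
      by (simp add: field_simps power2_eq_square)
    finally have "(\<Sum>k\<le>J. real n - real k * real L) \<le> real n + (real n)\<^sup>2 / (2 * real L)"
      unfolding sum_linear_progression using assms by (simp add: field_simps)
    also have "(real n)\<^sup>2 / (2 * real L) \<le> (real n)\<^sup>2 / (2 * (real s + 1))"
      using assms by (intro divide_left_mono) auto
    finally show ?thesis by simp
  qed
  have IJ: "real I \<le> real n" "real J \<le> real n" by (simp_all add: I_def J_def)
  have pn: "p n \<le> c * real n + 1"
    using card_parts_in_pair_bounds(2)[of s n] by (simp add: p_def c_def)
  have cA: "c * ((real n)\<^sup>2 / (2 * real s)) \<le> c * (\<Sum>k\<le>I. real n - real k * real s)"
    using A' c01 by (intro mult_left_mono) auto
  have cB: "c * (\<Sum>k\<le>J. real n - real k * real L) \<le> c * (real n + (real n)\<^sup>2 / (2 * (real s + 1)))"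
    using B' c01 by (intro mult_left_mono) auto
  \<comment> \<open>The errors are at most 2n + 3 from rounding and 2cn \<le> n from
    \<open>pn\<close> and \<open>cB\<close>, in total 3n + 3.\<close>
  have cn: "c * real n \<le> 1 / 2 * real n" using c01 by (intro mult_right_mono) auto
  have "c * ((real n)\<^sup>2 / (2 * real s)) - c * (real n + (real n)\<^sup>2 / (2 * (real s + 1))) =
     (real n)\<^sup>2 / (2 * real s * (real s + 1)\<^sup>2 * (real s + 2)) - c * real n"
    using assms by (simp add: c_def divide_simps power2_eq_square) (simp add: algebra_simps)
  then show ?thesis unfolding h using A B IJ pn cA cB cn by linarith
qed

section \<open>Removing a large or frequent part, and positivity of the convolution\<close>

text \<open>At most \<open>K\<close> distinct parts with multiplicity below \<open>K\<close> make at
  most \<open>K * K\<close> parts, each at most \<open>K - 1\<close>.\<close>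

lemma sum_mset_less_cube:
  fixes M :: "nat multiset"
  assumes "\<And>t. t \<in># M \<Longrightarrow> t < K" "\<And>t. count M t < K" "K > 0"
  shows "sum_mset M < K ^ 3"
proof -
  have "size M = (\<Sum>t\<in>set_mset M. count M t)" by (rule size_multiset_overloaded_eq)
  also have "\<dots> \<le> card (set_mset M) * K"
    using assms(2) by (intro sum_bounded_above[where K = K, simplified]) (simp add: less_imp_le)
  also have "card (set_mset M) \<le> card {..<K}" using assms(1) by (intro card_mono) auto
  finally have size: "size M \<le> K * K" by simp
  have "sum_mset M' \<le> size M' * (K - 1)" if "\<And>t. t \<in># M' \<Longrightarrow> t < K" for M' :: "nat multiset"
    using that
  proof (induction M')
    case (add x M')
    have "x \<le> K - 1" using add.prems[of x] by simp
    moreover have "sum_mset M' \<le> size M' * (K - 1)" using add by simp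
    ultimately show ?case by simp
  qed simp
  then have "sum_mset M \<le> size M * (K - 1)" using assms(1) by blast
  also have "\<dots> \<le> K * K * (K - 1)" using size by (rule mult_right_mono) simp
  also have "\<dots> < K * K * K" using assms(3) by simp
  finally show ?thesis by (simp add: power3_eq_cube)
qed

text \<open>By the cube bound, some part is at least \<open>K\<close> or occurs at least
  \<open>K\<close> times. Each multiset is thus recovered from a smaller one in one of two ways;
  overlaps are harmless for an upper bound.\<close>

lemma card_parts_in_le_removal:
  assumes "0 \<notin> U" "K > 0" "q \<ge> K ^ 3"
  shows "card (parts_in U q) \<le>
    (\<Sum>t | t \<in> U \<and> K \<le> t \<and> t \<le> q. card (parts_in U (q - t))) +
    (\<Sum>t | t \<in> U \<and> t < K \<and> K * t \<le> q. card (parts_in U (q - K * t)))"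
proof -
  let ?Z1 = "{t. t \<in> U \<and> K \<le> t \<and> t \<le> q}" and ?Z2 = "{t. t \<in> U \<and> t < K \<and> K * t \<le> q}"
  define A where "A = (\<lambda>t. add_mset t ` parts_in U (q - t))"
  define B where "B = (\<lambda>t. (\<lambda>M. replicate_mset K t + M) ` parts_in U (q - K * t))"
  have fin: "finite ?Z1" "finite ?Z2" by simp_all
  have finAB: "finite (A t)" "finite (B t)" for t
    by (simp_all add: A_def B_def finite_parts_in assms)
  have "parts_in U q \<subseteq> (\<Union>t\<in>?Z1. A t) \<union> (\<Union>t\<in>?Z2. B t)"
  proof
    fix M assume "M \<in> parts_in U q"
    then have M: "set_mset M \<subseteq> U" "sum_mset M = q" by (auto simp: parts_in_def)
    show "M \<in> (\<Union>t\<in>?Z1. A t) \<union> (\<Union>t\<in>?Z2. B t)"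
    proof (cases "\<exists>t. t \<in># M \<and> K \<le> t")
      case True
      then obtain t where t: "t \<in># M" "K \<le> t" by blast
      then obtain M' where M': "M = add_mset t M'" by (auto dest: multi_member_split)
      have "t + sum_mset M' = q" "set_mset M' \<subseteq> U" "t \<in> U" using M M' by auto
      then have "M' \<in> parts_in U (q - t)" "t \<in> ?Z1" using t by (auto simp: parts_in_def)
      then show ?thesis unfolding A_def M' by blast
    next
      case False
      have "\<exists>t. K \<le> count M t"
      proof (rule ccontr)
        assume "\<not> ?thesis"
        then have "sum_mset M < K ^ 3"
          using False assms(2) by (intro sum_mset_less_cube) (auto simp: not_le)
        with M assms(3) show False by simp
      qed
      then obtain t where t: "K \<le> count M t" by blast
      then have "replicate_mset K t \<subseteq># M" by (simp add: count_le_replicate_mset_subset_eq)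
      then obtain M' where M': "M = replicate_mset K t + M'" by (metis subset_mset.le_iff_add)
      have "t \<in># M" using t assms(2) by (metis count_greater_zero_iff less_le_trans)
      then have "t < K" "t \<in> U" using False M by auto
      moreover have "K * t + sum_mset M' = q" "set_mset M' \<subseteq> U" using M M' by auto
      ultimately have "M' \<in> parts_in U (q - K * t)" "t \<in> ?Z2" by (auto simp: parts_in_def)
      then show ?thesis unfolding B_def M' by blast
    qed
  qed
  then have "card (parts_in U q) \<le> card ((\<Union>t\<in>?Z1. A t) \<union> (\<Union>t\<in>?Z2. B t))"
    using fin finAB by (intro card_mono) auto
  also have "\<dots> \<le> card (\<Union>t\<in>?Z1. A t) + card (\<Union>t\<in>?Z2. B t)" by (rule card_Un_le)
  also have "\<dots> \<le> (\<Sum>t\<in>?Z1. card (A t)) + (\<Sum>t\<in>?Z2. card (B t))"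
    using fin by (intro add_mono card_UN_le)
  also have "\<dots> \<le> (\<Sum>t\<in>?Z1. card (parts_in U (q - t))) + (\<Sum>t\<in>?Z2. card (parts_in U (q - K * t)))"
    unfolding A_def B_def
    by (intro add_mono sum_mono card_image_le finite_parts_in assms)
  finally show ?thesis .
qed

text \<open>\<open>R\<close> collects the terms with nonnegative weight. Removal bounds each
  \<open>u (n - m)\<close> with \<open>m < N\<close> by values \<open>u (n - j)\<close> of weight
  \<open>h j\<close> at least \<open>K\<close>, so it is at most 2R/K. The \<open>N\<close>
  remaining terms, of weight at least -3N, lose at most 6 N^2 R / K, which is less than
  \<open>R\<close>.\<close>

lemma convolution_parts_pos:
  fixes h :: "nat \<Rightarrow> int" and N K n :: nat
  assumes U: "0 \<notin> U" and N: "N > 0" and K: "K = 6 * N\<^sup>2 + 1" and n: "n \<ge> N + K ^ 3"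
    and large: "\<And>j. j \<ge> N \<Longrightarrow> h j \<ge> int j"
    and small: "\<And>j. j < N \<Longrightarrow> h j \<ge> - 3 * int N"
  shows "(\<Sum>m\<le>n. h m * int (card (parts_in U (n - m)))) > 0"
proof -
  define u where "u = (\<lambda>m. int (card (parts_in U m)))"
  define R where "R = (\<Sum>j=N..n. h j * u (n - j))"
  have u0: "u m \<ge> 0" for m by (simp add: u_def)
  have hu0: "h j * u (n - j) \<ge> 0" if "j \<ge> N" for j
    using large[OF that] u0[of "n - j"] by simp
  have KN: "K \<ge> N" using self_le_power[of N 2] N unfolding K by simp
  have "u 0 = 1"
    using parts_in_empty_sum[of U 0] U by (auto simp: u_def intro: Nat.gr0I)
  then have "0 < h n * u (n - n)" using large[of n] n N by simp
  also have "\<dots> \<le> R" unfolding R_def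
    by (rule member_le_sum) (use n hu0 in auto)
  finally have R: "R > 0" .
  \<comment> \<open>Here \<open>g t\<close> is the amount removed, later \<open>t\<close> or
    \<open>K * t\<close>; injectivity ensures that each term of \<open>R\<close> is used at most
    once.\<close>
  have partial: "int K * (\<Sum>t\<in>Z. u (n - m - g t)) \<le> R"
    if g: "inj_on g Z" "\<And>t. t \<in> Z \<Longrightarrow> K \<le> g t \<and> g t \<le> n - m" "m \<le> n" for Z :: "nat set" and g m
  proof -
    have "int K * (\<Sum>t\<in>Z. u (n - m - g t)) \<le> (\<Sum>t\<in>Z. h (m + g t) * u (n - (m + g t)))"
      unfolding sum_distrib_left
    proof (rule sum_mono)
      fix t assume "t \<in> Z"
      then have "int K \<le> h (m + g t)" using large[of "m + g t"] g(2)[of t] KN by simp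
      then show "int K * u (n - m - g t) \<le> h (m + g t) * u (n - (m + g t))"
        using u0 by (simp add: mult_right_mono)
    qed
    also have "\<dots> = (\<Sum>j\<in>(\<lambda>t. m + g t) ` Z. h j * u (n - j))"
      using g(1) by (subst sum.reindex) (auto simp: inj_on_def)
    also have "\<dots> \<le> R" unfolding R_def
    proof (rule sum_mono2)
      show "(\<lambda>t. m + g t) ` Z \<subseteq> {N..n}" using g KN by fastforce
    qed (use hu0 in auto)
    finally show ?thesis .
  qed
  have Ku: "int K * u (n - m) \<le> 2 * R" if "m < N" for m
  proof -
    let ?Z1 = "{t. t \<in> U \<and> K \<le> t \<and> t \<le> n - m}" and ?Z2 = "{t. t \<in> U \<and> t < K \<and> K * t \<le> n - m}"
    have Kpos: "K > 0" using K by simp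
    have "n - m \<ge> K ^ 3" using n that by simp
    from card_parts_in_le_removal[OF U Kpos this]
    have "u (n - m) \<le> (\<Sum>t\<in>?Z1. u (n - m - t)) + (\<Sum>t\<in>?Z2. u (n - m - K * t))"
      unfolding u_def of_nat_sum[symmetric] of_nat_add[symmetric] of_nat_le_iff .
    then have "int K * u (n - m) \<le> int K * ((\<Sum>t\<in>?Z1. u (n - m - t)) + (\<Sum>t\<in>?Z2. u (n - m - K * t)))"
      by (intro mult_left_mono) auto
    also have "\<dots> = int K * (\<Sum>t\<in>?Z1. u (n - m - t)) + int K * (\<Sum>t\<in>?Z2. u (n - m - K * t))"
      by (rule distrib_left)
    also have "int K * (\<Sum>t\<in>?Z1. u (n - m - t)) \<le> R"
      by (rule partial) (use that n in auto)
    also have "int K * (\<Sum>t\<in>?Z2. u (n - m - K * t)) \<le> R"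
    proof (rule partial)
      fix t assume t: "t \<in> ?Z2"
      then have "t \<noteq> 0" using U by (metis (mono_tags, lifting) mem_Collect_eq)
      then show "K \<le> K * t \<and> K * t \<le> n - m" using t by simp
    qed (use that n Kpos in \<open>auto simp: inj_on_def\<close>)
    finally show ?thesis by simp
  qed
  define S where "S = (\<Sum>m<N. u (n - m))"
  have "int K * S \<le> (\<Sum>m<N. 2 * R)"
    unfolding S_def sum_distrib_left using Ku by (intro sum_mono) auto
  then have KS: "int K * S \<le> 2 * int N * R" by simp
  \<comment> \<open>Scaling by \<open>K\<close> avoids division; the choice of \<open>K\<close>
    leaves exactly one \<open>R\<close>.\<close>
  have "int K * (R - 3 * int N * S) = int K * R - 3 * int N * (int K * S)"
    by (simp add: algebra_simps)
  also have "\<dots> \<ge> int K * R - 3 * int N * (2 * int N * R)"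
    using KS by (intro diff_mono mult_left_mono) auto
  also have "int K * R - 3 * int N * (2 * int N * R) = R"
    by (simp add: K algebra_simps power2_eq_square)
  finally have "int K * (R - 3 * int N * S) > 0" using R by linarith
  then have RS: "R - 3 * int N * S > 0" by (simp add: zero_less_mult_iff)
  have "- 3 * int N * S \<le> (\<Sum>m<N. h m * u (n - m))"
    unfolding S_def sum_distrib_left using small u0 by (intro sum_mono mult_right_mono) auto
  moreover have "(\<Sum>m\<le>n. h m * u (n - m)) = (\<Sum>m<N. h m * u (n - m)) + R"
  proof -
    have "{..n} = {..<N} \<union> {N..n}" using n by auto
    then show ?thesis unfolding R_def by (simp add: sum.union_disjoint ivl_disj_int)
  qed
  ultimately show ?thesis using RS by (simp add: u_def)
qed

section \<open>Positivity of \<open>G\<close> from a polynomial bound onwards\<close>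

text \<open>\<open>N\<close> is seven times the denominator \<open>D\<close> of the quadratic bound:
  for j \<ge> N the quadratic term is at least 7j, which exceeds 3j + 3 by at least j. For j < N the
  bound -3j - 3 is at least -3N.\<close>

lemma G_nth_pos:
  fixes L s n :: nat
  defines "N \<equiv> 14 * s * (s + 1)\<^sup>2 * (s + 2)"
  assumes "s > 0" "L \<ge> s + 1" "n \<ge> N + (6 * N\<^sup>2 + 1) ^ 3"
  shows "G L s $ n > 0"
proof -
  define S where "S = {Suc s, Suc (Suc s)}"
  define U where "U = {s + 3..s + L}"
  define h where "h = part_gf S * (part_gf {s} - 1 - part_gf {L})"
  define D where "D = 2 * real s * (real s + 1)\<^sup>2 * (real s + 2)"
  have L: "L > 0" "L > s" using \<open>L \<ge> s + 1\<close> by auto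
  have N: "N > 0" using \<open>s > 0\<close> by (simp add: N_def)
  have "D > 0" unfolding D_def using \<open>s > 0\<close> by (intro mult_pos_pos) auto
  moreover have "real N = 7 * D" by (simp add: D_def N_def algebra_simps)
  ultimately have D: "D > 0" "real N = 7 * D" .
  have h: "real_of_int (h $ j) \<ge> (real j)\<^sup>2 / D - 3 * real j - 3" for j
    using pair_convolution_lower_bound[OF assms(2) L(2), of j] by (simp add: h_def S_def D_def)
  have "h $ j \<ge> int j" if "j \<ge> N" for j
  proof -
    have "real j \<ge> 7 * D" "real j \<ge> 1" using that D(2) N by linarith+
    then have "7 * real j \<le> (real j)\<^sup>2 / D"
      using D(1) mult_right_mono[of "7 * D" "real j" "real j"]
      by (simp add: pos_le_divide_eq power2_eq_square mult_ac)
    then have "real_of_int (h $ j) \<ge> real j" using h[of j] \<open>real j \<ge> 1\<close> by linarith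
    then show ?thesis by linarith
  qed
  moreover have "h $ j \<ge> - 3 * int N" if "j < N" for j
  proof -
    have "(real j)\<^sup>2 / D \<ge> 0" using D(1) by simp
    then have "real_of_int (h $ j) \<ge> - 3 * real N" using h[of j] that by linarith
    then show ?thesis by linarith
  qed
  ultimately have pos: "(\<Sum>m\<le>n. h $ m * int (card (parts_in U (n - m)))) > 0"
    using assms(4) N
    by (intro convolution_parts_pos[where N = N and K = "6 * N\<^sup>2 + 1"] refl) (simp_all add: U_def)
  \<comment> \<open>Since \<open>L\<close> is at least 2, both split-off parts lie in the interval;
    \<open>U\<close> is empty when \<open>L = 2\<close>.\<close>
  have "{Suc s..s + L} = insert (Suc s) (insert (Suc (Suc s)) U)"
    using \<open>s > 0\<close> \<open>L \<ge> s + 1\<close> by (auto simp: U_def)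
  moreover have "Suc s \<notin> insert (Suc (Suc s)) U" "Suc (Suc s) \<notin> U" "0 \<notin> U" by (auto simp: U_def)
  ultimately have "part_gf {Suc s..s + L} = part_gf U * part_gf {Suc (Suc s)} * part_gf {Suc s}"
    using part_gf_insert'[of "Suc s" "insert (Suc (Suc s)) U"] part_gf_insert'[of "Suc (Suc s)" U]
    by simp
  moreover have "part_gf S = part_gf {Suc (Suc s)} * part_gf {Suc s}"
    using part_gf_insert'[of "Suc s" "{Suc (Suc s)}"] by (simp add: S_def)
  ultimately have "part_gf {Suc s..s + L} = part_gf S * part_gf U"
    by (simp only: ac_simps)
  then have "G L s = h * part_gf U + part_gf {L}"
    using G_eq[OF assms(2) L(1)] by (simp add: h_def ac_simps)
  \<comment> \<open>The extra summand \<open>part_gf {L}\<close> has nonnegative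
    coefficients.\<close>
  then show ?thesis using pos by (simp add: fps_mult_nth atLeast0AtMost)
qed

section \<open>Comparison of the polynomial bound with \<open>\<delta>'\<close>\<close>

lemma P_ge:
  assumes "L \<ge> 4"
  shows "P L s \<ge> s + 4"
proof (rule dvd_imp_le)
  show "s + 4 dvd P L s" unfolding P_def by (rule dvd_prodI) (use assms in auto)
qed (simp add: P_def prod_pos)

text \<open>The base \<open>P L s\<close> is at least \<open>s + 4\<close> and the exponent at least
  24 * 5 + 2; the value 56 is 32 + 24, as required in \<open>\<delta>'_ge\<close>.\<close>

lemma \<Gamma>_ge:
  assumes "s > 0"
  shows "\<Gamma> s \<ge> (s + 4) ^ 56"
proof -
  define L where "L = 3 * s + 2"
  have P: "P L s \<ge> s + 4" by (rule P_ge) (use assms in \<open>simp add: L_def\<close>)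
  then have "(P L s)\<^sup>2 \<ge> 5\<^sup>2" using assms by (intro power_mono) auto
  then have "((P L s)\<^sup>2 - 1) * L \<ge> 24 * 5" using assms by (intro mult_mono) (auto simp: L_def)
  then have "(s + 4) ^ 56 \<le> (s + 4) ^ (((P L s)\<^sup>2 - 1) * L + 2)"
    by (intro power_increasing) auto
  also have "\<dots> \<le> P L s ^ (((P L s)\<^sup>2 - 1) * L + 2)" using P by (intro power_mono) auto
  also have "\<dots> \<le> 1 * (P L s ^ (((P L s)\<^sup>2 - 1) * L + 2) + (((P L s)\<^sup>2 - 1) * L - 2) * P L s)"
    by simp
  also have "\<dots> \<le> \<gamma> L s" unfolding \<gamma>_def
  proof (rule mult_right_mono)
    have "s + 1 \<le> (\<Sum>i = 1..L. s + i)" by (rule member_le_sum) (auto simp: L_def)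
    then show "1 \<le> (\<Sum>i = 1..L. s + i)" by simp
  qed simp
  finally show ?thesis by (simp add: \<Gamma>_def L_def)
qed

text \<open>In terms of \<open>x = s + 4\<close> the bound is at most 2^32 x^24, hence at most x^56,
  hence at most \<open>\<Gamma> s\<close>, which its exponential exceeds.\<close>

lemma \<delta>'_ge:
  fixes s :: nat
  defines "N \<equiv> 14 * s * (s + 1)\<^sup>2 * (s + 2)"
  assumes "s > 0"
  shows "\<delta>' s \<ge> real (N + (6 * N\<^sup>2 + 1) ^ 3)"
proof -
  define x where "x = s + 4"
  have x2: "2 ^ 32 \<le> x ^ 32" by (rule power_mono) (simp_all add: x_def)
  have x1: "1 \<le> x ^ k" for k by (simp add: x_def)
  have "N \<le> 14 * x * x\<^sup>2 * x"
    unfolding N_def by (intro mult_mono power_mono) (auto simp: x_def)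
  then have N: "N \<le> 14 * x ^ 4" by (simp add: power_numeral_reduce mult_ac)
  then have "N\<^sup>2 \<le> (14 * x ^ 4)\<^sup>2" by (rule power_mono) simp
  \<comment> \<open>The constant is 6 * 14^2 + 1.\<close>
  then have "6 * N\<^sup>2 + 1 \<le> 1177 * x ^ 8"
    using x1[of 8] by (simp add: power_mult_distrib flip: power_mult)
  then have "(6 * N\<^sup>2 + 1) ^ 3 \<le> (1177 * x ^ 8) ^ 3" by (rule power_mono) simp
  also have "\<dots> = 1177 ^ 3 * x ^ 24" by (simp add: power_mult_distrib flip: power_mult)
  finally have K: "(6 * N\<^sup>2 + 1) ^ 3 \<le> 1177 ^ 3 * x ^ 24" .
  have "x ^ 4 \<le> x ^ 24" by (rule power_increasing) (auto simp: x_def)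
  \<comment> \<open>Numerically, 14 + 1177^3 is below 2^32.\<close>
  with N K have "N + (6 * N\<^sup>2 + 1) ^ 3 \<le> 2 ^ 32 * x ^ 24" by simp
  also have "\<dots> \<le> x ^ 32 * x ^ 24" using x2 by (rule mult_right_mono) simp
  also have "\<dots> \<le> \<Gamma> s" using \<Gamma>_ge[OF assms(2)] by (simp add: x_def flip: power_add)
  finally have "real (N + (6 * N\<^sup>2 + 1) ^ 3) \<le> real (\<Gamma> s)" by (simp only: of_nat_le_iff)
  also have "\<dots> \<le> \<delta> s" unfolding \<delta>_def using exp_ge_add_one_self[of "3 * real (\<Gamma> s)"] by linarith
  also have "\<dots> \<le> 1 * (\<delta> s + 1)" by simp
  also have "\<dots> \<le> (real s + 2) * (real s + 3) * (\<delta> s + 1)"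
    by (rule mult_right_mono) (auto simp: \<delta>_def algebra_simps intro: add_nonneg_nonneg)
  also have "\<dots> \<le> \<delta>' s" by (simp add: \<delta>'_def)
  finally show ?thesis .
qed

theorem theorem4:
  fixes L s :: nat
  assumes "s > 0" and "L > 0" and "L \<ge> s + 1"
  shows "(\<forall>n::nat. real n \<ge> \<delta>' s \<longrightarrow> fps_nth (G L s) n > 0) \<and> eventually_positive (G L s)"
proof -
  have pos: "fps_nth (G L s) n > 0" if "real n \<ge> \<delta>' s" for n
    using \<delta>'_ge[OF assms(1)] that by (intro G_nth_pos[OF assms(1,3)]) linarith
  moreover have "eventually_positive (G L s)" unfolding eventually_positive_def
  proof (intro exI allI impI)
    fix n assume "nat \<lceil>\<delta>' s\<rceil> \<le> n"
    then have "real n \<ge> \<delta>' s" by linarith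
    then show "fps_nth (G L s) n > 0" by (rule pos)
  qed
  ultimately show ?thesis by blast
qed

end
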